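(* Let $A$ be a (nonempty) bounded subset of $\mathbb{R}^N$ such that there exist $\alpha>0$, $\mathcal M\in(0,+\infty)$ and $D\ge0$ satisfying $$|A_t|= t^{N-D}\left(\mathcal M+O(t^\alpha)\right)\quad\text{as } t\to0^+.$$ Then $\dim_BA=D$ and $A$ is Minkowski measurable with $\mathcal M^D(A)=\mathcal M$. Furthermore, the tube zeta function $\tilde\zeta_A$ has abscissa of convergence $D(\tilde\zeta_A)=D$ and possesses a unique meromorphic continuation (still denoted by $\tilde\zeta_A$) to (at least) the open right half-plane $\{\operatorname{Re} s>D-\alpha\}$; that is, $D_{\rm mer}(\tilde\zeta_A)\le D-\alpha$. The only pole of $\tilde\zeta_A$ in this half-plane is $s=D$; it is simple, and $\operatorname{res}(\tilde\zeta_A,D)=\mathcal M$.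
   Context: $N\ge1$. For $A\subset\mathbb{R}^N$ nonempty and bounded, $d(x,A)$ is the Euclidean distance from $x$ to $A$, $A_t:=\{x\in\mathbb{R}^N: d(x,A)<t\}$, and $|A_t|$ is the $N$-dimensional Lebesgue measure of $A_t$. For $r\ge0$, the upper and lower $r$-dimensional Minkowski contents are $\mathcal M^{*r}(A)=\limsup_{t\to0^+}|A_t|/t^{N-r}$ and $\mathcal M_*^{r}(A)=\liminf_{t\to0^+}|A_t|/t^{N-r}$. The upper (resp. lower) Minkowski dimension $\overline{\dim}_BA$ (resp. $\underline{\dim}_BA$) is $\inf\{r>0:\mathcal M^{*r}(A)=0\}$ (resp. the same with $\mathcal M_*^{r}$); if they coincide, the common value is $\dim_BA$. $A$ is Minkowski measurable if, with $D=\dim_BA$, $\mathcal M_*^D(A)=\mathcal M^{*D}(A)\in(0,+\infty)$; the common value is then denoted $\mathcal M^D(A)$. For a fixed $\delta>0$, the tube zeta function of $A$ is $\tilde\zeta_A(s)=\int_0^\delta t^{s-N-1}|A_t|\,dt$ for $\operatorname{Re}s$ sufficiently large. Its abscissa of convergence $D(\tilde\zeta_A)$ is the infimum of all real $\sigma\ge 0$ such that the integral converges (absolutely) at $s=\sigma$. For a function $f$, $D_{\rm mer}(f)$ is the infimum of all real $\sigma$ such that $f$ has a meromorphic extension to $\{\operatorname{Re}s>\sigma\}$. $\operatorname{res}(f,\omega)$ is the residue of $f$ at $\omega$. *)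

theory Defs
  imports "HOL-Complex_Analysis.Complex_Analysis" "HOL-Library.Landau_Symbols"
begin

definition tube :: "(real ^ 'n) set \<Rightarrow> real \<Rightarrow> (real ^ 'n) set" where
  "tube A t = {x. infdist x A < t}"

definition tube_vol :: "(real ^ 'n) set \<Rightarrow> real \<Rightarrow> real" where
  "tube_vol A t = measure lebesgue (tube A t)"

definition upper_minkowski_content :: "(real ^ 'n) set \<Rightarrow> real \<Rightarrow> ereal" where
  "upper_minkowski_content A r =
     Limsup (at_right 0) (\<lambda>t. ereal (tube_vol A t / t powr (real CARD('n) - r)))"

definition lower_minkowski_content :: "(real ^ 'n) set \<Rightarrow> real \<Rightarrow> ereal" where
  "lower_minkowski_content A r =
     Liminf (at_right 0) (\<lambda>t. ereal (tube_vol A t / t powr (real CARD('n) - r)))"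

text \<open>All infima over exponents are taken in the extended reals, so that the infimum of an
  empty set is \<open>\<infinity>\<close> and that of a set unbounded below is \<open>-\<infinity>\<close>.\<close>

definition upper_minkowski_dim :: "(real ^ 'n) set \<Rightarrow> ereal" where
  "upper_minkowski_dim A = Inf {ereal r | r. r > 0 \<and> upper_minkowski_content A r = 0}"

definition lower_minkowski_dim :: "(real ^ 'n) set \<Rightarrow> ereal" where
  "lower_minkowski_dim A = Inf {ereal r | r. r > 0 \<and> lower_minkowski_content A r = 0}"

definition has_minkowski_dim :: "(real ^ 'n) set \<Rightarrow> real \<Rightarrow> bool" where
  "has_minkowski_dim A D \<longleftrightarrow> upper_minkowski_dim A = ereal D \<and> lower_minkowski_dim A = ereal D"

definition has_minkowski_content :: "(real ^ 'n) set \<Rightarrow> real \<Rightarrow> real \<Rightarrow> bool" where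
  "has_minkowski_content A r c \<longleftrightarrow>
     lower_minkowski_content A r = ereal c \<and> upper_minkowski_content A r = ereal c"

definition minkowski_measurable :: "(real ^ 'n) set \<Rightarrow> bool" where
  "minkowski_measurable A \<longleftrightarrow>
     (\<exists>D c. has_minkowski_dim A D \<and> 0 < c \<and> has_minkowski_content A D c)"

definition tube_zeta_integrand :: "(real ^ 'n) set \<Rightarrow> complex \<Rightarrow> real \<Rightarrow> complex" where
  "tube_zeta_integrand A s t =
     complex_of_real t powr (s - of_nat CARD('n) - 1) * complex_of_real (tube_vol A t)"

text \<open>The value \<open>tube_zeta \<delta> A s\<close> is meaningful only to the right of the abscissa of convergence;
  where the integral does not converge absolutely, the Lebesgue integral is 0 by convention.\<close>

definition tube_zeta :: "real \<Rightarrow> (real ^ 'n) set \<Rightarrow> complex \<Rightarrow> complex" where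
  "tube_zeta \<delta> A s = (LINT t:{0<..<\<delta>}|lborel. tube_zeta_integrand A s t)"

definition tube_zeta_abscissa :: "real \<Rightarrow> (real ^ 'n) set \<Rightarrow> ereal" where
  "tube_zeta_abscissa \<delta> A =
     Inf {ereal \<sigma> | \<sigma>. \<sigma> \<ge> 0 \<and>
       set_integrable lborel {0<..<\<delta>} (tube_zeta_integrand A (complex_of_real \<sigma>))}"

definition right_half_plane :: "ereal \<Rightarrow> complex set" where
  "right_half_plane \<sigma> = {s. ereal (Re s) > \<sigma>}"

text \<open>\<open>g\<close> is a meromorphic extension to \<open>U\<close> of the function \<open>f\<close> with domain \<open>S\<close>. The notion
  \<open>nicely_meromorphic_on\<close> removes removable singularities and fixes the value 0 at poles,
  so that meromorphic functions are determined pointwise on \<open>U\<close>.\<close>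

definition meromorphic_extension ::
    "(complex \<Rightarrow> complex) \<Rightarrow> complex set \<Rightarrow> complex set \<Rightarrow> (complex \<Rightarrow> complex) \<Rightarrow> bool" where
  "meromorphic_extension f S U g \<longleftrightarrow> g nicely_meromorphic_on U \<and> (\<forall>s\<in>S \<inter> U. g s = f s)"

definition D_mer :: "(complex \<Rightarrow> complex) \<Rightarrow> complex set \<Rightarrow> ereal" where
  "D_mer f S =
     Inf {ereal \<sigma> | \<sigma>. \<exists>g. meromorphic_extension f S (right_half_plane (ereal \<sigma>)) g}"

end

theory Submission
  imports Defs "HOL-Real_Asymp.Real_Asymp"
begin

text \<open>
  Write \<open>|A\<^sub>t| = t\<^sup>N (M t powr -D + R t)\<close>. Since \<open>|A\<^sub>t|\<close> is bounded on \<open>(0, \<delta>)\<close>, the estimate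
  \<open>R t = O(t powr (\<alpha> - D))\<close> holds on all of \<open>(0, \<delta>)\<close>. The first term contributes
  \<open>M \<delta> powr (s - D) / (s - D)\<close> to the tube zeta function, and the second one its Mellin transform over
  \<open>(0, \<delta>)\<close>, which converges and is holomorphic for \<open>Re s > D - \<alpha>\<close>. At \<open>s = D\<close> the integral diverges like
  that of \<open>M / t\<close>, which fixes the abscissa of convergence.
\<close>

section \<open>Holomorphy of Mellin transforms\<close>

text \<open>Mean value inequality on the disc of radius \<open>norm z\<close>, where the derivative
  of \<open>exp\<close> is at most \<open>exp (norm z)\<close>.\<close>

lemma norm_exp_minus_one_le:
  fixes z :: complex
  shows "norm (exp z - 1) \<le> norm z * exp (norm z)"
proof -
  have "norm (exp z - exp 0) \<le> exp (norm z) * norm (z - 0)"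
  proof (rule field_differentiable_bound)
    fix w :: complex assume "w \<in> cball 0 (norm z)"
    then show "norm (exp w) \<le> exp (norm z)"
      using norm_exp[of w] by (meson exp_le_cancel_iff mem_cball_0 order_trans)
    show "(exp has_field_derivative exp w) (at w within cball 0 (norm z))"
      by (auto intro!: derivative_eq_intros)
  qed auto
  then show ?thesis by (simp add: mult.commute)
qed

lemma norm_of_real_powr_complex:
  assumes "t > 0"
  shows "norm (complex_of_real t powr s) = t powr Re s"
  using assms by (simp add: norm_powr_real_powr)

text \<open>One factor \<open>exp (\<epsilon> * \<bar>ln t\<bar>)\<close> absorbs the logarithm, a
  second one the exponential. Their product is one of the two powers of \<open>t\<close>, depending
  on the sign of \<open>ln t\<close>; the sum covers both cases.\<close>

lemma abs_ln_mult_exp_le: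
  fixes t \<epsilon> h :: real
  assumes "t > 0" "\<epsilon> > 0" "h \<le> \<epsilon>"
  shows "\<bar>ln t\<bar> * exp (h * \<bar>ln t\<bar>) \<le> (t powr (2 * \<epsilon>) + t powr (- 2 * \<epsilon>)) / \<epsilon>"
proof -
  have "\<epsilon> * \<bar>ln t\<bar> \<le> exp (\<epsilon> * \<bar>ln t\<bar>)"
    using exp_ge_add_one_self[of "\<epsilon> * \<bar>ln t\<bar>"] by linarith
  moreover have "exp (h * \<bar>ln t\<bar>) \<le> exp (\<epsilon> * \<bar>ln t\<bar>)"
    using assms by (simp add: mult_right_mono)
  ultimately have "(\<epsilon> * \<bar>ln t\<bar>) * exp (h * \<bar>ln t\<bar>) \<le> exp (\<epsilon> * \<bar>ln t\<bar>) * exp (\<epsilon> * \<bar>ln t\<bar>)"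
    using assms by (intro mult_mono) auto
  also have "\<dots> = exp (2 * \<epsilon> * \<bar>ln t\<bar>)"
    by (simp flip: exp_add)
  also have "\<dots> \<le> t powr (2 * \<epsilon>) + t powr (- 2 * \<epsilon>)"
    using assms by (cases "ln t \<ge> 0") (auto simp: powr_def)
  finally show ?thesis
    using assms by (simp add: field_simps)
qed

text \<open>
  The difference quotient of \<open>t powr (s - 1)\<close> in direction \<open>h\<close> with \<open>norm h < \<epsilon>\<close> is dominated by
  \<open>(t powr (Re s - 1 + 2 * \<epsilon>) + t powr (Re s - 1 - 2 * \<epsilon>)) / \<epsilon>\<close>, so dominated convergence only needs
  integrability at \<open>s \<plusminus> 2 * \<epsilon>\<close>.
\<close>

lemma mellin_holomorphic:
  fixes f :: "real \<Rightarrow> complex"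
  assumes X: "X \<subseteq> {0<..}"
    and int: "\<And>s. Re s > a \<Longrightarrow> set_integrable lborel X (\<lambda>t. of_real t powr (s - 1) * f t)"
  shows "(\<lambda>s. LINT t:X|lborel. of_real t powr (s - 1) * f t) holomorphic_on {s. Re s > a}"
proof -
  let ?F = "\<lambda>s. LINT t:X|lborel. of_real t powr (s - 1) * f t"
  define q where "q = (\<lambda>s t. indicator X t *\<^sub>R (complex_of_real t powr (s - 1) * f t))"
  have q_int: "integrable lborel (q s)" if "Re s > a" for s
    using int[OF that] unfolding set_integrable_def q_def .
  have F: "?F s = integral\<^sup>L lborel (q s)" for s
    by (simp add: set_lebesgue_integral_def q_def)
  have "\<exists>l. (?F has_field_derivative l) (at s)" if s: "Re s > a" for s
  proof -
    \<comment> \<open>A third of the distance to the boundary line, so that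
      \<open>s - 2 * \<epsilon>\<close> still lies in the open half-plane.\<close>
    define \<epsilon> where "\<epsilon> = (Re s - a) / 3"
    have \<epsilon>: "\<epsilon> > 0" and s\<epsilon>: "Re (s - of_real (2 * \<epsilon>)) > a" "Re (s + of_real (2 * \<epsilon>)) > a"
      using s by (auto simp: \<epsilon>_def field_simps)
    define w where "w t = (norm (q (s + of_real (2 * \<epsilon>)) t) + norm (q (s - of_real (2 * \<epsilon>)) t)) / \<epsilon>" for t
    \<comment> \<open>This isolates the difference quotient of \<open>exp (z * ln t)\<close> at
      \<open>z = 0\<close>, which tends to \<open>ln t\<close>.\<close>
    have quot: "(q (s + h) t - q s t) / h = q s t * ((exp (h * ln t) - 1) / h)" for h t
    proof (cases "t \<in> X")
      case True
      then have t: "t > 0" using X by auto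
      have "complex_of_real t powr (s + h - 1) = of_real t powr (s - 1) * exp (h * ln t)"
        using t by (simp add: powr_def Ln_of_real algebra_simps flip: exp_add)
      with True show ?thesis by (simp add: q_def algebra_simps diff_divide_distrib)
    qed (simp add: q_def)
    have "((\<lambda>h. (?F (s + h) - ?F s) / h) \<longlongrightarrow> (LINT t|lborel. q s t * of_real (ln t))) (at 0)"
      unfolding tendsto_at_iff_sequentially
    proof safe
      fix h :: "nat \<Rightarrow> complex" assume h0: "\<forall>i. h i \<in> UNIV - {0}" and h: "h \<longlonglongrightarrow> 0"
      from h \<epsilon> have "\<forall>\<^sub>F i in sequentially. norm (h i) < \<epsilon>"
        by (metis tendsto_norm_zero order_tendstoD(2))
      then obtain i0 where i0: "\<And>i. i \<ge> i0 \<Longrightarrow> norm (h i) < \<epsilon>"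
        by (auto simp: eventually_sequentially)
      \<comment> \<open>Dominated convergence is applied along sequences. Dropping the first
        \<open>i0\<close> terms makes the bound by \<open>w\<close> valid for every index; the limit
        does not change.\<close>
      define k where "k i = h (i + i0)" for i
      have k: "norm (k i) < \<epsilon>" "k i \<noteq> 0" for i
        using i0 h0 by (auto simp: k_def)
      have k_lim: "k \<longlonglongrightarrow> 0"
        unfolding k_def using h by (rule LIMSEQ_ignore_initial_segment)
      have ks: "Re (s + k i) > a" for i
        using k[of i] abs_Re_le_cmod[of "k i"] \<epsilon> s by (simp add: \<epsilon>_def)
      have "(\<lambda>i. LINT t|lborel. q s t * ((exp (k i * ln t) - 1) / k i))
              \<longlonglongrightarrow> (LINT t|lborel. q s t * of_real (ln t))"
      proof (rule integral_dominated_convergence[where w = w])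
        show "(\<lambda>t. q s t * of_real (ln t)) \<in> borel_measurable lborel"
          using q_int[OF s] by measurable
        show "(\<lambda>t. q s t * ((exp (k i * ln t) - 1) / k i)) \<in> borel_measurable lborel" for i
          using q_int[OF s] by measurable
        show "integrable lborel w"
          unfolding w_def using q_int[OF s\<epsilon>(1)] q_int[OF s\<epsilon>(2)] by simp
        show "AE t in lborel. (\<lambda>i. q s t * ((exp (k i * ln t) - 1) / k i)) \<longlonglongrightarrow> q s t * of_real (ln t)"
        proof (rule AE_I2, rule tendsto_mult_left)
          fix t :: real
          have "((\<lambda>z. exp (z * of_real (ln t)) :: complex) has_field_derivative of_real (ln t)) (at 0)"
            by (auto intro!: derivative_eq_intros)
          then have "((\<lambda>z. (exp (z * of_real (ln t)) - 1) / z :: complex) \<longlongrightarrow> of_real (ln t)) (at 0)"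
            unfolding DERIV_def by simp
          then show "(\<lambda>i. (exp (k i * of_real (ln t)) - 1) / k i) \<longlonglongrightarrow> of_real (ln t)"
            by (rule filterlim_compose) (use k_lim k in \<open>auto simp: filterlim_at\<close>)
        qed
        show "AE t in lborel. norm (q s t * ((exp (k i * ln t) - 1) / k i)) \<le> w t" for i
        proof (rule AE_I2)
          fix t :: real
          show "norm (q s t * ((exp (k i * ln t) - 1) / k i)) \<le> w t"
          proof (cases "t \<in> X")
            case True
            then have t: "t > 0" using X by auto
            have "norm ((exp (k i * ln t) - 1) / k i) \<le> \<bar>ln t\<bar> * exp (norm (k i) * \<bar>ln t\<bar>)"
              using norm_exp_minus_one_le[of "k i * ln t"] k(2)[of i]
              by (simp add: norm_divide norm_mult field_simps)
            also have "\<dots> \<le> (t powr (2 * \<epsilon>) + t powr (- 2 * \<epsilon>)) / \<epsilon>"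
              using abs_ln_mult_exp_le[OF t \<epsilon>] k(1)[of i] by simp
            finally have "norm (q s t * ((exp (k i * ln t) - 1) / k i))
                \<le> norm (q s t) * ((t powr (2 * \<epsilon>) + t powr (- 2 * \<epsilon>)) / \<epsilon>)"
              unfolding norm_mult by (rule mult_left_mono) simp
            also have "\<dots> = w t"
              using True t \<epsilon> by (simp add: w_def q_def norm_mult norm_of_real_powr_complex field_simps flip: powr_add)
            finally show ?thesis .
          qed (simp add: q_def w_def)
        qed
      qed
      moreover have "(?F (s + k i) - ?F s) / k i = (LINT t|lborel. q s t * ((exp (k i * ln t) - 1) / k i))" for i
        unfolding F quot[symmetric] using q_int[OF s] q_int[OF ks] by simp
      ultimately have "(\<lambda>i. (?F (s + k i) - ?F s) / k i) \<longlonglongrightarrow> (LINT t|lborel. q s t * of_real (ln t))"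
        by (simp only:)
      then show "((\<lambda>h. (?F (s + h) - ?F s) / h) \<circ> h) \<longlonglongrightarrow> (LINT t|lborel. q s t * of_real (ln t))"
        unfolding k_def o_def by (rule LIMSEQ_offset)
    qed
    then show ?thesis
      unfolding DERIV_def by blast
  qed
  then show ?thesis
    by (subst holomorphic_on_open) (auto simp: open_halfspace_Re_gt)
qed

section \<open>Integrals of powers over an interval at 0\<close>

text \<open>The norm of the integrand is the real power \<open>t powr (Re s - 1)\<close>. Its gauge
  integrability is absolute by nonnegativity and then passes from \<open>lebesgue\<close> to
  \<open>lborel\<close>.\<close>

lemma set_integrable_powr_complex:
  assumes "Re s > 0"
  shows "set_integrable lborel {0<..<c::real} (\<lambda>t. complex_of_real t powr (s - 1))"
proof -
  have "(\<lambda>t. t powr (Re s - 1)) integrable_on {0..c}"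
    by (cases "c \<ge> 0") (use assms in \<open>auto intro!: integrable_on_powr_from_0\<close>)
  then have "set_integrable lebesgue {0..c} (\<lambda>t. t powr (Re s - 1))"
    by (subst absolutely_integrable_on_iff_nonneg) auto
  then have "set_integrable lebesgue {0<..<c} (\<lambda>t. t powr (Re s - 1))"
    by (rule set_integrable_subset) auto
  then have "set_integrable lborel {0<..<c} (\<lambda>t. t powr (Re s - 1))"
    unfolding set_integrable_def by (subst integrable_completion[symmetric]) auto
  then show ?thesis
    unfolding set_integrable_def
    by (rule Bochner_Integration.integrable_bound)
       (auto simp: indicator_def norm_of_real_powr_complex intro!: AE_I2)
qed

text \<open>Fundamental theorem of calculus with antiderivative \<open>t powr s / s\<close>.
  Differentiability is used only in the interior; at 0 the antiderivative is continuous with value 0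
  because \<open>Re s > 0\<close>.\<close>

lemma set_integral_powr_complex:
  assumes "Re s > 0" "c > 0"
  shows "(LINT t:{0<..<c::real}|lborel. complex_of_real t powr (s - 1)) = of_real c powr s / s"
proof -
  let ?f = "\<lambda>t. complex_of_real t powr (s - 1)"
  have s0: "s \<noteq> 0" using assms by auto
  have "(?f has_integral (of_real c powr s / s - of_real 0 powr s / s)) {0..c}"
  proof (rule fundamental_theorem_of_calculus_interior)
    have "continuous (at t within {0..c}) (\<lambda>t. complex_of_real t powr s)" if "t \<in> {0..c}" for t
    proof (cases "t = 0")
      case True
      have "((\<lambda>t. complex_of_real t powr s) \<longlongrightarrow> 0) (at 0 within {0..c})"
        by (rule tendsto_powr_complex_0)
           (use assms in \<open>auto intro!: tendsto_eq_intros\<close>)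
      with True show ?thesis by (simp add: continuous_within)
    next
      case False
      with that have "isCont (\<lambda>t. complex_of_real t powr s) t"
        by (intro isCont_powr_complex) (auto simp: complex_nonpos_Reals_iff)
      then show ?thesis by (rule continuous_at_imp_continuous_at_within)
    qed
    then have "continuous_on {0..c} (\<lambda>t. complex_of_real t powr s)"
      by (simp add: continuous_on_eq_continuous_within)
    then show "continuous_on {0..c} (\<lambda>t. complex_of_real t powr s / s)"
      by (rule continuous_on_divide) (auto simp: s0)
    fix t assume t: "t \<in> {0<..<c}"
    then have "((\<lambda>z. z powr s / s) has_field_derivative (complex_of_real t powr (s - 1))) (at (of_real t))"
      using s0 by (auto intro!: derivative_eq_intros simp: complex_nonpos_Reals_iff)
    then show "((\<lambda>t. complex_of_real t powr s / s) has_vector_derivative ?f t) (at t)"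
      using has_vector_derivative_real_field by fastforce
  qed (use assms in auto)
  then have "(?f has_integral (of_real c powr s / s)) {0<..<c}"
    by (simp add: has_integral_Icc_iff_Ioo)
  moreover have "(?f has_integral (LINT t:{0<..<c}|lborel. ?f t)) {0<..<c}"
    using set_borel_integral_eq_integral[OF set_integrable_powr_complex[OF assms(1)]]
    by (simp add: has_integral_iff)
  ultimately show ?thesis
    by (rule has_integral_unique[symmetric])
qed

text \<open>A finite integral would bound \<open>ln c - ln e\<close> for all \<open>e\<close> in
  \<open>(0, c)\<close>, but this tends to infinity as \<open>e\<close> tends to 0.\<close>

lemma not_set_integrable_inverse:
  assumes "c > 0"
  shows "\<not> set_integrable lborel {0<..<c::real} (\<lambda>t. 1 / t)"
proof
  assume int: "set_integrable lborel {0<..<c::real} (\<lambda>t. 1 / t)"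
  define I where "I = (LINT t:{0<..<c}|lborel. 1 / t)"
  have "ln c - ln e \<le> I" if "0 < e" "e < c" for e
  proof -
    have "((\<lambda>t. 1 / t) has_integral (ln c - ln e)) {e..c}"
      using that by (intro fundamental_theorem_of_calculus)
        (auto intro!: derivative_eq_intros simp flip: has_real_derivative_iff_has_vector_derivative)
    then have 1: "((\<lambda>t. 1 / t) has_integral (ln c - ln e)) {e<..<c}"
      by (simp add: has_integral_Icc_iff_Ioo)
    have 2: "((\<lambda>t. 1 / t) has_integral I) {0<..<c}"
      using set_borel_integral_eq_integral[OF int] by (simp add: has_integral_iff I_def)
    show ?thesis
      by (rule has_integral_subset_le[OF _ 1 2]) (use that in auto)
  qed
  \<comment> \<open>The first entry of the minimum keeps the point below \<open>c\<close>; the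
    second forces \<open>ln c - ln e\<close> to be at least \<open>I + 1\<close>.\<close>
  from this[of "min (c / 2) (exp (ln c - I - 1))"] assms
  have "ln c - I \<le> ln (min (c / 2) (exp (ln c - I - 1)))"
    by (simp add: min.strict_coboundedI1)
  also have "\<dots> \<le> ln (exp (ln c - I - 1))"
    using assms by (subst ln_le_cancel_iff) auto
  finally show False by simp
qed

text \<open>Comparison with a multiple of \<open>t powr (Re s + b - 1)\<close>, which is integrable
  at 0 because \<open>Re s + b > 0\<close>.\<close>

lemma set_integrable_mellin_of_bound:
  fixes f :: "real \<Rightarrow> complex"
  assumes [measurable]: "f \<in> borel_measurable lborel"
    and bound: "\<And>t. t \<in> {0<..<c} \<Longrightarrow> norm (f t) \<le> K * t powr b"
    and s: "Re s + b > 0"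
  shows "set_integrable lborel {0<..<c} (\<lambda>t. of_real t powr (s - 1) * f t)"
proof -
  have "set_integrable lborel {0<..<c} (\<lambda>t. of_real K * complex_of_real t powr (s + of_real b - 1))"
    using s by (intro set_integrable_mult_right set_integrable_powr_complex) auto
  then show ?thesis
    unfolding set_integrable_def
  proof (rule Bochner_Integration.integrable_bound)
    show "AE t in lborel. norm (indicat_real {0<..<c} t *\<^sub>R (of_real t powr (s - 1) * f t))
        \<le> norm (indicat_real {0<..<c} t *\<^sub>R (of_real K * complex_of_real t powr (s + of_real b - 1)))"
    proof (rule AE_I2)
      fix t
      show "norm (indicat_real {0<..<c} t *\<^sub>R (of_real t powr (s - 1) * f t))
        \<le> norm (indicat_real {0<..<c} t *\<^sub>R (of_real K * complex_of_real t powr (s + of_real b - 1)))"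
      proof (cases "t \<in> {0<..<c}")
        case True
        then have "t powr (Re s - 1) * norm (f t) \<le> t powr (Re s - 1) * (\<bar>K\<bar> * t powr b)"
          using bound[OF True] by (intro mult_left_mono) (auto intro: order_trans mult_right_mono)
        also have "\<dots> = \<bar>K\<bar> * t powr (Re s + b - 1)"
          by (simp add: algebra_simps flip: powr_add)
        finally show ?thesis
          using True by (simp add: norm_mult norm_of_real_powr_complex)
      qed simp
    qed
  qed measurable
qed

section \<open>Simple poles and uniqueness of meromorphic continuation\<close>

text \<open>The continued zeta function will have this form, with \<open>H p\<close> as its residue.
  The value 0 at \<open>p\<close> is the one that \<open>nicely_meromorphic_on\<close> prescribes at
  a pole.\<close>

lemma simple_pole_quotient:
  fixes H :: "complex \<Rightarrow> complex"
  assumes "open U" "p \<in> U" and H: "H holomorphic_on U" and Hp: "H p \<noteq> 0"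
  defines "f \<equiv> \<lambda>s. if s = p then 0 else H s / (s - p)"
  shows "f nicely_meromorphic_on U" "{s \<in> U. is_pole f s} = {p}"
    "zorder f p = -1" "residue f p = H p"
proof -
  have ev: "\<forall>\<^sub>F s in at p. f s = H s / (s - p)"
    by (auto simp: f_def eventually_at_filter)
  have "is_pole (\<lambda>s. H s / (s - p)) p"
    using is_pole_basic[OF H assms(1,2) Hp, of 1] by simp
  then have pole: "is_pole f p"
    using is_pole_cong[OF ev refl] by simp
  have "(\<lambda>s. H s / (s - p)) holomorphic_on U - {p}"
    using H by (auto intro!: holomorphic_intros intro: holomorphic_on_subset)
  then have "f holomorphic_on U - {p}"
    by (rule holomorphic_transform) (auto simp: f_def)
  then have an: "f analytic_on U - {p}"
    using assms by (subst analytic_on_open) auto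
  show "f nicely_meromorphic_on U"
  proof (rule nicely_meromorphic_onI_open[where pts = "{p}"])
    fix x assume x: "x \<in> U"
    show "isolated_singularity_at f x"
    proof (cases "x = p")
      case True
      then show ?thesis
        using an assms(1,2)
        by (auto intro!: isolated_singularity_at_holomorphic[where s = U] dest: analytic_imp_holomorphic)
    next
      case False
      with x have "f analytic_on {x}" using an by (auto intro: analytic_on_subset)
      then show ?thesis by (rule isolated_singularity_at_analytic)
    qed
  qed (use assms an pole in \<open>auto simp: f_def\<close>)
  have "\<not> is_pole f s" if "s \<in> U" "s \<noteq> p" for s
    using an that by (intro analytic_at_imp_no_pole) (auto intro: analytic_on_subset)
  with pole assms show "{s \<in> U. is_pole f s} = {p}" by auto
  show "zorder f p = -1"
    by (rule zorder_eqI[OF assms(1,2) H Hp]) (auto simp: f_def power_int_minus divide_inverse)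
  have "residue f p = residue (\<lambda>s. H s / (s - p)) p"
    using ev by (rule residue_cong) simp
  also have "\<dots> = H p"
    using assms by (intro residue_simple) auto
  finally show "residue f p = H p" .
qed

text \<open>On a connected open set the meromorphic difference either vanishes or is nonzero, in
  both cases off a sparse set. Agreement on the nonempty open set \<open>T\<close> excludes the
  second alternative.\<close>

lemma nicely_meromorphic_on_identity:
  assumes f: "f nicely_meromorphic_on U" and g: "g nicely_meromorphic_on U"
    and "open U" "connected U" "open T" "T \<noteq> {}" "T \<subseteq> U"
    and eq: "\<And>s. s \<in> T \<Longrightarrow> f s = g s" and s: "s \<in> U"
  shows "f s = g s"
proof -
  have "(\<lambda>s. f s - g s) meromorphic_on U"
    using f g by (auto simp: nicely_meromorphic_on_def intro: meromorphic_intros)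
  then have "(\<forall>\<^sub>\<approx>s\<in>U. f s - g s = 0) \<or> (\<forall>\<^sub>\<approx>s\<in>U. f s - g s \<noteq> 0)"
    using assms by (intro meromorphic_imp_constant_or_avoid) auto
  moreover have "\<not> (\<forall>\<^sub>\<approx>s\<in>U. f s - g s \<noteq> 0)"
  proof
    assume *: "\<forall>\<^sub>\<approx>s\<in>U. f s - g s \<noteq> 0"
    from \<open>T \<noteq> {}\<close> obtain t where t: "t \<in> T" by auto
    have "\<forall>\<^sub>F s in at t. f s - g s \<noteq> 0"
      using * t assms by (auto simp: eventually_cosparse_open_eq)
    moreover have "\<forall>\<^sub>F s in at t. s \<in> T"
      using t \<open>open T\<close> by (auto intro: eventually_at_in_open')
    ultimately have "\<forall>\<^sub>F s in at t. False"
      by eventually_elim (use eq in auto)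
    then show False by simp
  qed
  ultimately have ev: "\<forall>\<^sub>F z in at s. f z = g z"
    using s \<open>open U\<close> by (auto simp: eventually_cosparse_open_eq)
  \<comment> \<open>From a punctured neighbourhood to the point itself: at a common pole both values
    are 0, elsewhere each value is the limit of its function.\<close>
  show ?thesis
  proof (cases "is_pole f s")
    case True
    then have "is_pole g s" using is_pole_cong[OF ev refl] by simp
    with True show ?thesis
      using is_pole_zero_at_nicely_mero f g s by metis
  next
    case False
    then have "\<not> is_pole g s" using is_pole_cong[OF ev refl] by simp
    with False f g s have "(f \<longlongrightarrow> f s) (at s)" "(g \<longlongrightarrow> g s) (at s)"
      by (auto simp: nicely_meromorphic_on_def)
    moreover from this(2) have "(f \<longlongrightarrow> g s) (at s)"
      using tendsto_cong[OF ev] by blast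
    ultimately show ?thesis
      using tendsto_unique by (metis at_neq_bot)
  qed
qed

section \<open>Volumes of tubes around a bounded set\<close>

lemma bounded_tube:
  fixes A :: "(real ^ 'n) set"
  assumes "A \<noteq> {}" "bounded A"
  shows "bounded (tube A t)"
proof -
  obtain r where r: "\<And>a. a \<in> A \<Longrightarrow> norm a \<le> r"
    using assms by (auto simp: bounded_iff)
  have "norm x \<le> r + t" if x: "x \<in> tube A t" for x
  proof -
    have "(INF a\<in>A. dist x a) < t"
      using x assms by (simp add: tube_def infdist_notempty)
    then obtain a where a: "a \<in> A" "dist x a < t"
      using cInf_lessD[of "dist x ` A" t] assms by auto
    then show ?thesis
      using r[OF a(1)] norm_triangle_ineq2[of x a] by (simp add: dist_norm)
  qed
  then show ?thesis by (auto simp: bounded_iff)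
qed

text \<open>Tubes are open and bounded, hence of finite measure, so the default value 0 of
  \<open>measure\<close> on sets of infinite measure does not interfere. Monotonicity later yields
  both the Borel measurability of \<open>tube_vol A\<close> and its bound on
  \<open>(0, \<delta>]\<close>.\<close>

lemma mono_tube_vol:
  fixes A :: "(real ^ 'n) set"
  assumes "A \<noteq> {}" "bounded A"
  shows "mono (tube_vol A)"
proof
  fix t u :: real assume "t \<le> u"
  have "tube A r \<in> lmeasurable" for r
    using bounded_tube[OF assms] unfolding tube_def
    by (intro lmeasurable_open open_Collect_less continuous_intros) auto
  with \<open>t \<le> u\<close> show "tube_vol A t \<le> tube_vol A u"
    unfolding tube_vol_def by (intro measure_mono_fmeasurable fmeasurableD) (auto simp: tube_def)
qed

section \<open>Functions with a power law at 0\<close>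

text \<open>The asymptotics give the estimate only on some \<open>(0, b)\<close>. On the rest of the
  interval \<open>t\<close> stays away from 0, where boundedness of \<open>V\<close> and compactness
  of \<open>[b, c]\<close> suffice.\<close>

lemma power_law_remainder:
  fixes V E :: "real \<Rightarrow> real"
  assumes E: "E \<in> O[at_right 0](\<lambda>t. t powr \<alpha>)"
    and V: "\<forall>\<^sub>F t in at_right 0. V t = t powr (n - D) * (M + E t)"
    and bound: "\<And>t. 0 < t \<Longrightarrow> t \<le> c \<Longrightarrow> \<bar>V t\<bar> \<le> B"
  obtains K where "\<And>t. t \<in> {0<..<c} \<Longrightarrow> \<bar>t powr - n * V t - M * t powr - D\<bar> \<le> K * t powr (\<alpha> - D)"
proof -
  obtain k where k: "\<forall>\<^sub>F t in at_right 0. norm (E t) \<le> k * norm (t powr \<alpha>)"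
    using E by (elim landau_o.bigE)
  from V k have "\<forall>\<^sub>F t in at_right 0. \<bar>t powr - n * V t - M * t powr - D\<bar> \<le> k * t powr (\<alpha> - D)"
    using eventually_at_right_less[of 0]
  proof eventually_elim
    case (elim t)
    then have "t powr - n * V t - M * t powr - D = t powr - D * E t"
      by (simp add: algebra_simps flip: powr_add)
    moreover have "t powr - D * \<bar>E t\<bar> \<le> t powr - D * (k * t powr \<alpha>)"
      using elim by (intro mult_left_mono) auto
    ultimately show ?case
      by (simp add: abs_mult algebra_simps flip: powr_add)
  qed
  then obtain b where b: "b > 0" and near:
    "\<And>t. 0 < t \<Longrightarrow> t < b \<Longrightarrow> \<bar>t powr - n * V t - M * t powr - D\<bar> \<le> k * t powr (\<alpha> - D)"
    by (auto simp: eventually_at_right_field)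
  \<comment> \<open>The crude bound \<open>B * t powr - n + \<bar>M\<bar> * t powr - D\<close>,
    divided by \<open>t powr (\<alpha> - D)\<close>.\<close>
  have "bounded ((\<lambda>t. B * t powr (D - n - \<alpha>) + \<bar>M\<bar> * t powr - \<alpha>) ` {b..c})"
    using b by (intro compact_imp_bounded compact_continuous_image continuous_intros) auto
  then obtain L where L: "\<And>t. t \<in> {b..c} \<Longrightarrow> \<bar>B * t powr (D - n - \<alpha>) + \<bar>M\<bar> * t powr - \<alpha>\<bar> \<le> L"
    unfolding bounded_iff by fastforce
  show ?thesis
  proof (rule that[of "max k L"])
    fix t assume t: "t \<in> {0<..<c}"
    show "\<bar>t powr - n * V t - M * t powr - D\<bar> \<le> max k L * t powr (\<alpha> - D)"
    proof (cases "t < b")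
      case True
      then have "\<bar>t powr - n * V t - M * t powr - D\<bar> \<le> k * t powr (\<alpha> - D)"
        using near t by auto
      also have "\<dots> \<le> max k L * t powr (\<alpha> - D)"
        by (intro mult_right_mono) auto
      finally show ?thesis .
    next
      case False
      have "\<bar>t powr - n * V t - M * t powr - D\<bar> \<le> \<bar>t powr - n * V t\<bar> + \<bar>M * t powr - D\<bar>"
        by (rule abs_triangle_ineq4)
      also have "\<dots> \<le> t powr - n * B + \<bar>M\<bar> * t powr - D"
        using bound[of t] t by (auto simp: abs_mult intro!: mult_left_mono)
      also have "\<dots> = (B * t powr (D - n - \<alpha>) + \<bar>M\<bar> * t powr - \<alpha>) * t powr (\<alpha> - D)"
        by (simp add: algebra_simps flip: powr_add)
      also have "\<dots> \<le> max k L * t powr (\<alpha> - D)"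
        using L[of t] t False by (intro mult_right_mono) auto
      finally show ?thesis .
    qed
  qed
qed

text \<open>The quotient equals \<open>t powr (r - D) * (M + E t)\<close> near 0. Since the second
  factor tends to \<open>M > 0\<close>, the sign of \<open>r - D\<close> decides the limit.\<close>

lemma power_law_limits:
  fixes V E :: "real \<Rightarrow> real"
  assumes "\<alpha> > 0" "M > 0" and E: "E \<in> O[at_right 0](\<lambda>t. t powr \<alpha>)"
    and V: "\<forall>\<^sub>F t in at_right 0. V t = t powr (n - D) * (M + E t)"
  shows "((\<lambda>t. V t / t powr (n - D)) \<longlongrightarrow> M) (at_right 0)"
    and "r > D \<Longrightarrow> ((\<lambda>t. V t / t powr (n - r)) \<longlongrightarrow> 0) (at_right 0)"
    and "r < D \<Longrightarrow> filterlim (\<lambda>t. V t / t powr (n - r)) at_top (at_right 0)"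
proof -
  have powr0: "((\<lambda>t. t powr b) \<longlongrightarrow> 0) (at_right (0::real))" if "b > 0" for b :: real
    using that by real_asymp
  have powr_top: "filterlim (\<lambda>t. t powr b) at_top (at_right (0::real))" if "b < 0" for b :: real
    using that by real_asymp
  obtain k where "\<forall>\<^sub>F t in at_right 0. norm (E t) \<le> k * norm (t powr \<alpha>)"
    using E by (elim landau_o.bigE)
  moreover have "((\<lambda>t. k * norm (t powr \<alpha>)) \<longlongrightarrow> 0) (at_right 0)"
    using powr0[OF \<open>\<alpha> > 0\<close>] by (intro tendsto_mult_right_zero tendsto_norm_zero)
  ultimately have "(E \<longlongrightarrow> 0) (at_right 0)"
    by (rule Lim_null_comparison)
  then have ME: "((\<lambda>t. M + E t) \<longlongrightarrow> M) (at_right 0)"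
    by (auto intro!: tendsto_eq_intros)
  have eq: "\<forall>\<^sub>F t in at_right 0. t powr (r - D) * (M + E t) = V t / t powr (n - r)" for r
    using V eventually_at_right_less[of 0]
    by eventually_elim (simp add: powr_diff)
  show "((\<lambda>t. V t / t powr (n - D)) \<longlongrightarrow> M) (at_right 0)"
  proof (rule Lim_transform_eventually[OF ME])
    show "\<forall>\<^sub>F t in at_right 0. M + E t = V t / t powr (n - D)"
      using eq[of D] eventually_at_right_less[of 0] by eventually_elim simp
  qed
  show "((\<lambda>t. V t / t powr (n - r)) \<longlongrightarrow> 0) (at_right 0)" if "r > D"
    using that tendsto_mult[OF powr0 ME, of "r - D"]
    by (intro Lim_transform_eventually[OF _ eq]) auto
  show "filterlim (\<lambda>t. V t / t powr (n - r)) at_top (at_right 0)" if "r < D"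
  proof (rule iffD1[OF filterlim_cong[OF refl refl eq]])
    show "filterlim (\<lambda>t. t powr (r - D) * (M + E t)) at_top (at_right 0)"
      using that \<open>M > 0\<close>
      by (subst mult.commute) (intro filterlim_tendsto_pos_mult_at_top[OF ME] powr_top; simp)
  qed
qed

section \<open>Minkowski contents and dimension\<close>

lemma minkowski_content_eq_limit:
  fixes A :: "(real ^ 'n) set"
  assumes "((\<lambda>t. ereal (tube_vol A t / t powr (real CARD('n) - r))) \<longlongrightarrow> L) (at_right 0)"
  shows "upper_minkowski_content A r = L" "lower_minkowski_content A r = L"
  using assms unfolding upper_minkowski_content_def lower_minkowski_content_def
  by (auto intro: lim_imp_Limsup lim_imp_Liminf)

text \<open>Both Minkowski dimensions and the abscissa of convergence turn out to be infima of this
  set.\<close>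

lemma Inf_ereal_greaterThan:
  "Inf {ereal r | r. r > D} = ereal D"
proof (rule antisym)
  show "Inf {ereal r | r. r > D} \<le> ereal D"
  proof (rule dense_le)
    fix y :: ereal assume y: "y < Inf {ereal r | r. r > D}"
    show "y \<le> ereal D"
    proof (rule ccontr)
      assume "\<not> y \<le> ereal D"
      then have "ereal D < y" by simp
      then obtain r where r: "ereal D < ereal r" "ereal r < y"
        using ereal_dense2 by blast
      then have "Inf {ereal r | r. r > D} \<le> ereal r"
        by (intro Inf_lower) auto
      with r y show False by (meson leD less_trans)
    qed
  qed
  show "ereal D \<le> Inf {ereal r | r. r > D}"
    by (rule Inf_greatest) auto
qed

lemma minkowski_dim_and_content_of_power_law:
  fixes A :: "(real ^ 'n) set" and E :: "real \<Rightarrow> real"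
  assumes "\<alpha> > 0" "M > 0" "D \<ge> 0" and E: "E \<in> O[at_right 0](\<lambda>t. t powr \<alpha>)"
    and V: "\<forall>\<^sub>F t in at_right 0. tube_vol A t = t powr (real CARD('n) - D) * (M + E t)"
  shows "has_minkowski_dim A D" "has_minkowski_content A D M"
proof -
  note lims = power_law_limits[OF assms(1,2) E V]
  have at_D: "upper_minkowski_content A D = ereal M" "lower_minkowski_content A D = ereal M"
    using lims(1) by (auto intro!: minkowski_content_eq_limit)
  have above: "upper_minkowski_content A r = 0" "lower_minkowski_content A r = 0" if "r > D" for r
    using lims(2)[OF that] by (auto intro!: minkowski_content_eq_limit simp: zero_ereal_def)
  have below: "upper_minkowski_content A r = \<infinity>" "lower_minkowski_content A r = \<infinity>" if "r < D" for r
    using lims(3)[OF that] by (auto intro!: minkowski_content_eq_limit simp: tendsto_PInfty_eq_at_top)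
  \<comment> \<open>The contents are \<infinity> below \<open>D\<close>, the positive number
    \<open>M\<close> at \<open>D\<close>, and 0 above \<open>D\<close>. As \<open>D \<ge> 0\<close>,
    every \<open>r > D\<close> is positive.\<close>
  have "r > 0 \<and> upper_minkowski_content A r = 0 \<longleftrightarrow> r > D"
    "r > 0 \<and> lower_minkowski_content A r = 0 \<longleftrightarrow> r > D" for r
    using at_D above[of r] below[of r] assms(2,3)
    by (cases r D rule: linorder_cases; force)+
  then show "has_minkowski_dim A D"
    by (simp add: has_minkowski_dim_def upper_minkowski_dim_def lower_minkowski_dim_def
        Inf_ereal_greaterThan)
  show "has_minkowski_content A D M"
    using at_D by (simp add: has_minkowski_content_def)
qed

section \<open>The tube zeta function of a power law\<close>

text \<open>\<open>G\<close> is the Mellin transform of the remainder over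
  \<open>(0, \<delta>)\<close>. The explicit quotient carries the singularity at
  \<open>D\<close>.\<close>

lemma tube_zeta_of_power_law:
  fixes A :: "(real ^ 'n) set" and E :: "real \<Rightarrow> real"
  assumes A: "A \<noteq> {}" "bounded A" and "\<alpha> > 0" "M > 0" "\<delta> > 0"
    and E: "E \<in> O[at_right 0](\<lambda>t. t powr \<alpha>)"
    and V: "\<forall>\<^sub>F t in at_right 0. tube_vol A t = t powr (real CARD('n) - D) * (M + E t)"
  obtains G where "G holomorphic_on {s. Re s > D - \<alpha>}"
    and "\<And>s. Re s > D \<Longrightarrow> tube_zeta \<delta> A s = of_real M * of_real \<delta> powr (s - of_real D) / (s - of_real D) + G s"
    and "\<And>\<sigma>. set_integrable lborel {0<..<\<delta>} (tube_zeta_integrand A (of_real \<sigma>)) \<longleftrightarrow> \<sigma> > D"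
proof -
  let ?n = "real CARD('n)"
  \<comment> \<open>The factor \<open>t powr - n\<close> of the integrand is moved into the
    remainder, so that the kernel becomes the Mellin kernel \<open>t powr (s - 1)\<close>.\<close>
  define R where "R = (\<lambda>t. t powr - ?n * tube_vol A t - M * t powr - D)"
  have [measurable]: "tube_vol A \<in> borel_measurable borel"
    using A by (intro borel_measurable_mono mono_tube_vol)
  have R_meas: "(\<lambda>t. complex_of_real (R t)) \<in> borel_measurable lborel"
    unfolding R_def by measurable
  have "\<bar>tube_vol A t\<bar> \<le> tube_vol A \<delta>" if "0 < t" "t \<le> \<delta>" for t
    using monoD[OF mono_tube_vol[OF A] that(2)] by (simp add: tube_vol_def)
  from power_law_remainder[OF E V this]
  obtain K where K: "\<And>t. t \<in> {0<..<\<delta>} \<Longrightarrow> \<bar>R t\<bar> \<le> K * t powr (\<alpha> - D)"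
    unfolding R_def by blast
  have R_int: "set_integrable lborel {0<..<\<delta>} (\<lambda>t. of_real t powr (s - 1) * of_real (R t))"
    if "Re s > D - \<alpha>" for s
    by (rule set_integrable_mellin_of_bound[OF R_meas, of _ K "\<alpha> - D"]) (use K that in auto)
  have split: "tube_zeta_integrand A s t =
      of_real M * of_real t powr (s - of_real D - 1) + of_real t powr (s - 1) * of_real (R t)"
    if "t \<in> {0<..<\<delta>}" for s t
  proof -
    have *: "complex_of_real t powr (s - of_real a - 1) = of_real t powr (s - 1) * of_real (t powr - a)" for a
      using that by (simp add: algebra_simps flip: powr_of_real powr_add)
    show ?thesis
      using *[of ?n] *[of D] by (simp add: tube_zeta_integrand_def R_def algebra_simps)
  qed
  have split_integrable: "set_integrable lborel {0<..<\<delta>} (tube_zeta_integrand A s) \<longleftrightarrow>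
      set_integrable lborel {0<..<\<delta>} (\<lambda>t. of_real M * of_real t powr (s - of_real D - 1)
        + of_real t powr (s - 1) * of_real (R t))" for s
    using split by (intro set_integrable_cong) auto
  have M_int: "set_integrable lborel {0<..<\<delta>} (\<lambda>t. of_real M * complex_of_real t powr (s - of_real D - 1))"
    if "Re s > D" for s
    using that by (intro set_integrable_mult_right set_integrable_powr_complex) auto
  \<comment> \<open>It is enough to refute convergence at \<open>D\<close>: for
    \<open>\<sigma> \<le> D\<close> and \<open>t < \<delta>\<close>, the factor
    \<open>t powr (D - \<sigma>)\<close> is at most \<open>\<delta> powr (D - \<sigma>)\<close>, so
    convergence at \<open>\<sigma>\<close> would imply convergence at \<open>D\<close>.\<close>
  have not_int: "\<not> set_integrable lborel {0<..<\<delta>} (tube_zeta_integrand A (of_real \<sigma>))" if "\<sigma> \<le> D" for \<sigma>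
  proof
    assume int: "set_integrable lborel {0<..<\<delta>} (tube_zeta_integrand A (of_real \<sigma>))"
    have "set_integrable lborel {0<..<\<delta>} (\<lambda>t. of_real (\<delta> powr (D - \<sigma>)) * tube_zeta_integrand A (of_real \<sigma>) t)"
      using int by (intro set_integrable_mult_right)
    then have "set_integrable lborel {0<..<\<delta>} (tube_zeta_integrand A (of_real D))"
      unfolding set_integrable_def
    proof (rule Bochner_Integration.integrable_bound)
      show "AE t in lborel. norm (indicat_real {0<..<\<delta>} t *\<^sub>R tube_zeta_integrand A (of_real D) t)
        \<le> norm (indicat_real {0<..<\<delta>} t *\<^sub>R (of_real (\<delta> powr (D - \<sigma>)) * tube_zeta_integrand A (of_real \<sigma>) t))"
      proof (rule AE_I2)
        fix t
        have "t powr (D - ?n - 1) \<le> \<delta> powr (D - \<sigma>) * t powr (\<sigma> - ?n - 1)" if "t \<in> {0<..<\<delta>}"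
        proof -
          have "t powr (D - ?n - 1) = t powr (D - \<sigma>) * t powr (\<sigma> - ?n - 1)"
            by (simp add: algebra_simps flip: powr_add)
          also have "\<dots> \<le> \<delta> powr (D - \<sigma>) * t powr (\<sigma> - ?n - 1)"
            using that \<open>\<sigma> \<le> D\<close> by (intro mult_right_mono powr_mono2) auto
          finally show ?thesis .
        qed
        then show "norm (indicat_real {0<..<\<delta>} t *\<^sub>R tube_zeta_integrand A (of_real D) t)
          \<le> norm (indicat_real {0<..<\<delta>} t *\<^sub>R (of_real (\<delta> powr (D - \<sigma>)) * tube_zeta_integrand A (of_real \<sigma>) t))"
          by (cases "t \<in> {0<..<\<delta>}")
             (auto simp: tube_zeta_integrand_def norm_mult norm_of_real_powr_complex
               simp flip: mult.assoc intro!: mult_right_mono)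
      qed
    qed (unfold tube_zeta_integrand_def, measurable)
    \<comment> \<open>The remainder is integrable at \<open>D\<close> because
      \<open>\<alpha> > 0\<close>. Subtracting it leaves \<open>M / t\<close>, which is not
      integrable at 0.\<close>
    then have "set_integrable lborel {0<..<\<delta>}
        (\<lambda>t. tube_zeta_integrand A (of_real D) t - of_real t powr (of_real D - 1) * of_real (R t))"
      using R_int[of "of_real D"] \<open>\<alpha> > 0\<close> by (intro set_integral_diff) auto
    also have "?this \<longleftrightarrow> set_integrable lborel {0<..<\<delta>} (\<lambda>t. of_real M * complex_of_real t powr (-1))"
      using split by (intro set_integrable_cong) auto
    finally have "set_integrable lborel {0<..<\<delta>} (\<lambda>t. norm (of_real M * complex_of_real t powr (-1)))"
      by (rule set_integrable_norm)
    then have "set_integrable lborel {0<..<\<delta>} (\<lambda>t. (1 / M) * norm (of_real M * complex_of_real t powr (-1)))"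
      by (rule set_integrable_mult_right)
    also have "?this \<longleftrightarrow> set_integrable lborel {0<..<\<delta>} (\<lambda>t. 1 / t)"
      using \<open>M > 0\<close> by (intro set_integrable_cong)
        (auto simp: norm_mult norm_divide norm_of_real_powr_complex powr_minus_divide)
    finally show False
      using not_set_integrable_inverse[OF \<open>\<delta> > 0\<close>] by simp
  qed
  show ?thesis
  proof
    show "(\<lambda>s. LINT t:{0<..<\<delta>}|lborel. of_real t powr (s - 1) * of_real (R t)) holomorphic_on {s. Re s > D - \<alpha>}"
      by (rule mellin_holomorphic) (use R_int in auto)
    show "tube_zeta \<delta> A s = of_real M * of_real \<delta> powr (s - of_real D) / (s - of_real D)
        + (LINT t:{0<..<\<delta>}|lborel. of_real t powr (s - 1) * of_real (R t))" if s: "Re s > D" for s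
    proof -
      have "tube_zeta \<delta> A s = (LINT t:{0<..<\<delta>}|lborel. of_real M * of_real t powr (s - of_real D - 1)
          + of_real t powr (s - 1) * of_real (R t))"
        unfolding tube_zeta_def using split by (intro set_lebesgue_integral_cong) auto
      also have "\<dots> = (LINT t:{0<..<\<delta>}|lborel. of_real M * of_real t powr (s - of_real D - 1))
          + (LINT t:{0<..<\<delta>}|lborel. of_real t powr (s - 1) * of_real (R t))"
        using M_int[OF s] R_int[of s] s \<open>\<alpha> > 0\<close> by (intro set_integral_add(2)) auto
      also have "(LINT t:{0<..<\<delta>}|lborel. of_real M * complex_of_real t powr (s - of_real D - 1))
          = of_real M * of_real \<delta> powr (s - of_real D) / (s - of_real D)"
        using s \<open>\<delta> > 0\<close> set_integral_powr_complex[of "s - of_real D" \<delta>] by simp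
      finally show ?thesis .
    qed
    show "set_integrable lborel {0<..<\<delta>} (tube_zeta_integrand A (of_real \<sigma>)) \<longleftrightarrow> \<sigma> > D" for \<sigma>
    proof
      assume "\<sigma> > D"
      then show "set_integrable lborel {0<..<\<delta>} (tube_zeta_integrand A (of_real \<sigma>))"
        unfolding split_integrable using M_int[of "of_real \<sigma>"] R_int[of "of_real \<sigma>"] \<open>\<alpha> > 0\<close>
        by (intro set_integral_add(1)) auto
    qed (use not_int[of \<sigma>] in linarith)
  qed
qed

theorem theorem4p1:
  fixes A :: "(real ^ 'n) set" and \<alpha> M D \<delta> :: real and E :: "real \<Rightarrow> real"
  assumes "A \<noteq> {}" and "bounded A"
    and "\<alpha> > 0" and "M > 0" and "D \<ge> 0" and "\<delta> > 0"
    and "E \<in> O[at_right 0](\<lambda>t. t powr \<alpha>)"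
    and "\<forall>\<^sub>F t in at_right 0. tube_vol A t = t powr (real CARD('n) - D) * (M + E t)"
  defines "S \<equiv> right_half_plane (tube_zeta_abscissa \<delta> A)"
    and "U \<equiv> right_half_plane (ereal (D - \<alpha>))"
  shows "has_minkowski_dim A D \<and>
    minkowski_measurable A \<and>
    has_minkowski_content A D M \<and>
    tube_zeta_abscissa \<delta> A = ereal D \<and>
    (\<exists>\<zeta>. meromorphic_extension (tube_zeta \<delta> A) S U \<zeta> \<and>
         (\<forall>g. meromorphic_extension (tube_zeta \<delta> A) S U g \<longrightarrow> (\<forall>s\<in>U. g s = \<zeta> s)) \<and>
         {s \<in> U. is_pole \<zeta> s} = {complex_of_real D} \<and>
         zorder \<zeta> (complex_of_real D) = -1 \<and>
         residue \<zeta> (complex_of_real D) = complex_of_real M) \<and>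
    D_mer (tube_zeta \<delta> A) S \<le> ereal (D - \<alpha>)"
proof -
  have dim: "has_minkowski_dim A D" "has_minkowski_content A D M"
    using minkowski_dim_and_content_of_power_law[OF assms(3,4,5,7,8)] .
  then have meas: "minkowski_measurable A"
    using assms(4) unfolding minkowski_measurable_def by blast
  obtain G where G: "G holomorphic_on {s. Re s > D - \<alpha>}"
    and zeta: "\<And>s. Re s > D \<Longrightarrow>
      tube_zeta \<delta> A s = of_real M * of_real \<delta> powr (s - of_real D) / (s - of_real D) + G s"
    and int: "\<And>\<sigma>. set_integrable lborel {0<..<\<delta>} (tube_zeta_integrand A (of_real \<sigma>)) \<longleftrightarrow> \<sigma> > D"
    using tube_zeta_of_power_law[OF assms(1-4,6-8)] by blast
  \<comment> \<open>The restriction to nonnegative exponents in the abscissa is automatic above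
    \<open>D \<ge> 0\<close>.\<close>
  have "\<sigma> \<ge> 0 \<and> \<sigma> > D \<longleftrightarrow> \<sigma> > D" for \<sigma>
    using assms(5) by linarith
  then have abscissa: "tube_zeta_abscissa \<delta> A = ereal D"
    by (simp add: tube_zeta_abscissa_def int Inf_ereal_greaterThan)
  have S: "S = {s. Re s > D}" and U: "U = {s. Re s > D - \<alpha>}"
    by (simp_all add: S_def U_def abscissa right_half_plane_def)
  have U_props: "open U" "connected U" "complex_of_real D \<in> U"
    using assms(3) unfolding U
    by (auto simp: open_halfspace_Re_gt intro!: convex_connected convex_halfspace_Re_gt)
  have S_props: "open S" "S \<noteq> {}" "S \<subseteq> U"
    using assms(3) unfolding U S by (auto simp: open_halfspace_Re_gt intro!: exI[of _ "of_real (D + 1)"])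
  \<comment> \<open>\<open>H\<close> is the zeta function multiplied by \<open>s - D\<close>. It is
    holomorphic on \<open>U\<close>, and its value at \<open>D\<close> is \<open>M\<close> because
    \<open>\<delta> powr 0 = 1\<close>.\<close>
  define H where "H = (\<lambda>s. of_real M * of_real \<delta> powr (s - of_real D) + (s - of_real D) * G s)"
  define \<zeta> where "\<zeta> = (\<lambda>s. if s = of_real D then 0 else H s / (s - of_real D))"
  have H: "H holomorphic_on U" "H (of_real D) = of_real M"
    using G assms(6) unfolding H_def U by (auto intro!: holomorphic_intros)
  note pole = simple_pole_quotient[OF U_props(1,3) H(1), folded \<zeta>_def, unfolded H(2)]
  have "\<zeta> s = tube_zeta \<delta> A s" if "s \<in> S" for s
    using that zeta[of s] by (auto simp: S \<zeta>_def H_def divide_simps)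
  then have ext: "meromorphic_extension (tube_zeta \<delta> A) S U \<zeta>"
    using pole(1) assms(4) by (auto simp: meromorphic_extension_def)
  \<comment> \<open>Two extensions agree on \<open>S\<close>, a nonempty open subset of the
    connected set \<open>U\<close>.\<close>
  have unique: "g s = \<zeta> s" if "meromorphic_extension (tube_zeta \<delta> A) S U g" "s \<in> U" for g s
    by (rule nicely_meromorphic_on_identity[OF _ _ U_props(1,2) S_props])
       (use that ext S_props in \<open>auto simp: meromorphic_extension_def\<close>)
  have "D_mer (tube_zeta \<delta> A) S \<le> ereal (D - \<alpha>)"
    unfolding D_mer_def using ext by (intro Inf_lower) (auto simp: U_def)
  with dim meas abscissa ext unique pole assms(4) show ?thesis
    by (auto intro!: exI[of _ \<zeta>])
qed

end
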